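(* Suppose $\Sigma$ is a finite set with $2\le|\Sigma|<\infty$ and let $r>0$. If $\hat c\in\mathcal{C}_{\mathrm{DRO}}(X\times\mathcal{P}(\Sigma))$, with ambiguity sets $\mathcal{A}(\hat P)$, is a reasonably feasible DRO predictor at rate $r$, then $$\{P\in\mathcal{P}(\Sigma):D_{\mathrm{KL}}(\hat P,P)\le r\}\subseteq\mathcal{A}(\hat P)\qquad\text{for every }\hat P\in\mathcal{P}(\Sigma).$$
   Context: $X\subseteq\mathbb{R}^m$ is a nonempty set of decisions. $\Sigma$ is a finite set equipped with all subsets as $\sigma$-algebra, and $\mathcal{P}(\Sigma)=\{P\in\mathbb{R}^{|\Sigma|}:\sum_{i\in\Sigma}P(i)=1,\ P(i)\ge0\}$ with the topology induced from $\mathbb{R}^{|\Sigma|}$. For a loss $\ell:X\times\Sigma\to\mathbb{R}$ put $c(x,P):=\mathbb{E}_P[\ell(x,\xi)]$. For $P\in\mathcal{P}(\Sigma)$, $\xi_1,\xi_2,\dots$ are i.i.d. samples from $P$, $P_N:=\frac1N\sum_{i=1}^N\delta_{\xi_i}$, and $\mathrm{Prob}$ is the probability under this sampling; $\log 0=-\infty$. $D_{\mathrm{KL}}(P',P)=\sum_{\xi}P'(\xi)\log\frac{P'(\xi)}{P(\xi)}$ if $P'\ll P$ ($0\log0=0$), and $+\infty$ otherwise. DRO predictors: $\mathcal{C}_{\mathrm{DRO}}(X\times\mathcal{P}(\Sigma))$ consists of predictors of the form $\hat c(x,\hat P)=\sup\{c(x,P):P\in\mathcal{A}(\hat P)\}$,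 where for each $\hat P\in\mathcal{P}(\Sigma)$ the ambiguity set $\mathcal{A}(\hat P)\subseteq\mathcal{P}(\Sigma)$ is nonempty, closed and convex, depends only on $\hat P$ and not on the loss function, and where $\hat P\mapsto\hat c(x,\hat P)$ is upper semicontinuous for each $x\in X$. Thus a fixed ambiguity map $\mathcal{A}$ yields a predictor $\hat c$ for each loss function, and the upper semicontinuity is required for the losses under consideration, in particular for all decision-free losses. A loss is decision-free if $\ell(x,\xi)\equiv\ell_0(\xi)$ for some continuous $\ell_0:\Sigma\to\mathbb{R}$. A DRO predictor is reasonably feasible at rate $r$ if, for every decision-free loss function $\ell$, it is uniformly feasible at rate $r$: $\sup_{P\in\mathcal{P}(\Sigma)}\limsup_{N\to\infty}\frac1N\log\mathrm{Prob}[\exists x\in X:c(x,P)>\hat c(x,P_N)]\le -r$. *)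

theory Defs
  imports "HOL-Probability.Probability"
begin

text \<open>
  The finite sample space is the universe of a finite type \<open>'s\<close>; an element of
  $R^{|\Sigma|}$ is a vector of type \<open>real ^ 's\<close>, carrying the Euclidean topology.
\<close>

definition prob_vecs :: "(real ^ 's::finite) set" where
  "prob_vecs = {P. (\<Sum>i\<in>UNIV. P $ i) = 1 \<and> (\<forall>i. 0 \<le> P $ i)}"

definition dist_of :: "real ^ 's::finite \<Rightarrow> 's measure" where
  "dist_of P = point_measure UNIV (\<lambda>i. ennreal (P $ i))"

definition cost :: "('x \<Rightarrow> 's \<Rightarrow> real) \<Rightarrow> 'x \<Rightarrow> real ^ 's::finite \<Rightarrow> real" where
  "cost l x P = (\<integral>\<xi>. l x \<xi> \<partial>dist_of P)"

text \<open>
  The law of an i.i.d. sequence of samples. Sequences are indexed from 0, so that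
  \<open>\<omega> i\<close> is the sample $\xi_{i+1}$.
\<close>

definition sampling :: "real ^ 's::finite \<Rightarrow> (nat \<Rightarrow> 's) measure" where
  "sampling P = Pi\<^sub>M UNIV (\<lambda>_. dist_of P)"

text \<open>\<open>axis s 1\<close> is the point mass at \<open>s\<close>.\<close>

definition empirical :: "nat \<Rightarrow> (nat \<Rightarrow> 's) \<Rightarrow> real ^ 's::finite" where
  "empirical N \<omega> = (1 / real N) *\<^sub>R (\<Sum>i<N. axis (\<omega> i) 1)"

definition elog :: "real \<Rightarrow> ereal" where
  "elog p = (if p = 0 then -\<infinity> else ereal (ln p))"

text \<open>
  The summand for \<open>Q $ i = 0\<close> vanishes whatever \<open>P $ i\<close> is, in accordance with $0 \log 0 = 0$.
\<close>

definition KL_div :: "real ^ 's::finite \<Rightarrow> real ^ 's \<Rightarrow> ereal" where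
  "KL_div Q P =
     (if \<forall>i. P $ i = 0 \<longrightarrow> Q $ i = 0
      then ereal (\<Sum>i\<in>UNIV. Q $ i * ln (Q $ i / P $ i)) else \<infinity>)"

definition usc_on :: "'a::topological_space set \<Rightarrow> ('a \<Rightarrow> real) \<Rightarrow> bool" where
  "usc_on S f \<longleftrightarrow> (\<forall>a. openin (top_of_set S) {p \<in> S. f p < a})"

text \<open>
  Only the values of a loss on the decision set \<open>X\<close> matter. The sample space carries the
  discrete topology.
\<close>

definition decision_free :: "'x set \<Rightarrow> ('x \<Rightarrow> 's::finite \<Rightarrow> real) \<Rightarrow> bool" where
  "decision_free X l \<longleftrightarrow>
     (\<exists>l0. continuous_map (discrete_topology UNIV) euclideanreal l0 \<and> (\<forall>x\<in>X. \<forall>\<xi>. l x \<xi> = l0 \<xi>))"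

text \<open>
  \<open>L\<close> is the class of losses under consideration and \<open>c l\<close> is the predictor for the loss \<open>l\<close>;
  the ambiguity map \<open>A\<close> is common to all losses. The supremum is that of a nonempty bounded set
  of reals.
\<close>

definition DRO_predictor ::
  "'x set \<Rightarrow> ('x \<Rightarrow> 's \<Rightarrow> real) set \<Rightarrow> (real ^ 's::finite \<Rightarrow> (real ^ 's) set) \<Rightarrow>
   (('x \<Rightarrow> 's \<Rightarrow> real) \<Rightarrow> 'x \<Rightarrow> real ^ 's \<Rightarrow> real) \<Rightarrow> bool" where
  "DRO_predictor X L A c \<longleftrightarrow>
     (\<forall>Q\<in>prob_vecs. A Q \<subseteq> prob_vecs \<and> A Q \<noteq> {} \<and> closed (A Q) \<and> convex (A Q)) \<and>
     (\<forall>l\<in>L. \<forall>x\<in>X. (\<forall>Q\<in>prob_vecs. c l x Q = (SUP P\<in>A Q. cost l x P)) \<and> usc_on prob_vecs (c l x))"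

definition uniformly_feasible ::
  "'x set \<Rightarrow> ('x \<Rightarrow> 's \<Rightarrow> real) \<Rightarrow> ('x \<Rightarrow> real ^ 's::finite \<Rightarrow> real) \<Rightarrow> real \<Rightarrow> bool" where
  "uniformly_feasible X l chat r \<longleftrightarrow>
     (SUP P\<in>prob_vecs. limsup (\<lambda>N. ereal (1 / real N) *
        elog (\<P>(\<omega> in sampling P. \<exists>x\<in>X. cost l x P > chat x (empirical N \<omega>))))) \<le> ereal (- r)"

definition reasonably_feasible ::
  "'x set \<Rightarrow> (('x \<Rightarrow> 's \<Rightarrow> real) \<Rightarrow> 'x \<Rightarrow> real ^ 's::finite \<Rightarrow> real) \<Rightarrow> real \<Rightarrow> bool" where
  "reasonably_feasible X c r \<longleftrightarrow> (\<forall>l. decision_free X l \<longrightarrow> uniformly_feasible X l (c l) r)"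

end

theory Submission
  imports Defs "HOL-Real_Asymp.Real_Asymp"
begin

text \<open>
  If \<open>P\<^sub>0\<close> with \<open>KL_div Q P\<^sub>0 \<le> r\<close> were outside the closed convex set \<open>A Q\<close>, a separating hyperplane
  would give a decision-free loss whose cost at \<open>P\<^sub>0\<close> exceeds the prediction at \<open>Q\<close>. Moving \<open>P\<^sub>0\<close>
  slightly towards \<open>Q\<close> keeps this strict inequality and, by concavity of the logarithm, makes the
  divergence strictly smaller than \<open>r\<close>. By upper semicontinuity the prediction still falls short of
  the cost on a neighbourhood of \<open>Q\<close>. The lower bound in Sanov's theorem, proved by a
  change of measure from \<open>P\<close> to \<open>Q\<close> and the law of large numbers under \<open>Q\<close>, then shows that the
  probability of disappointment decays at a rate strictly slower than \<open>r\<close>.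
\<close>

section \<open>The law of finitely many i.i.d. samples\<close>

lemma space_dist_of [simp]: "space (dist_of P) = UNIV"
  and sets_dist_of [simp]: "sets (dist_of P) = UNIV"
  by (simp_all add: dist_of_def space_point_measure sets_point_measure)

lemma space_sampling [simp]: "space (sampling P) = UNIV"
  by (simp add: sampling_def space_PiM)

lemma prob_space_dist_of:
  assumes "P \<in> prob_vecs"
  shows "prob_space (dist_of P)"
proof
  have "emeasure (dist_of P) UNIV = (\<Sum>i\<in>UNIV. ennreal (P $ i))"
    by (simp add: dist_of_def emeasure_point_measure_finite)
  also have "\<dots> = ennreal (\<Sum>i\<in>UNIV. P $ i)"
    using assms by (intro sum_ennreal) (auto simp: prob_vecs_def)
  finally show "emeasure (dist_of P) (space (dist_of P)) = 1"
    using assms by (simp add: prob_vecs_def)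
qed

lemma measure_dist_of_singleton:
  assumes "P \<in> prob_vecs"
  shows "measure (dist_of P) {s} = P $ s"
  using assms
  by (simp add: dist_of_def measure_def emeasure_point_measure_finite prob_vecs_def)

lemma integral_dist_of:
  fixes f :: "'s::finite \<Rightarrow> real"
  assumes "P \<in> prob_vecs"
  shows "(\<integral>\<xi>. f \<xi> \<partial>dist_of P) = (\<Sum>i\<in>UNIV. P $ i * f i)"
  using assms unfolding dist_of_def
  by (subst lebesgue_integral_point_measure_finite) (auto simp: prob_vecs_def)

lemma product_prob_space_dist_of:
  assumes "P \<in> prob_vecs"
  shows "product_prob_space (\<lambda>_. dist_of P)"
  using prob_space_dist_of[OF assms]
  by (simp add: product_prob_space_def product_prob_space_axioms_def product_sigma_finite_def
      prob_space_imp_sigma_finite)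

lemma prob_space_sampling:
  assumes "P \<in> prob_vecs"
  shows "prob_space (sampling P)"
  unfolding sampling_def by (rule prob_space_PiM) (rule prob_space_dist_of[OF assms])

text \<open>A cylinder is the embedding of a finite box of singletons, so the product measure
  factors over its \<open>N\<close> coordinates.\<close>

lemma
  fixes P :: "real ^ 's::finite"
  assumes "P \<in> prob_vecs"
  shows sets_sampling_cylinder: "{\<omega>. \<forall>i<N. \<omega> i = x i} \<in> sets (sampling P)"
    and measure_sampling_cylinder:
      "measure (sampling P) {\<omega>. \<forall>i<N. \<omega> i = x i} = (\<Prod>i<N. P $ x i)"
proof -
  interpret product_prob_space "\<lambda>_::nat. dist_of P" UNIV
    by (rule product_prob_space_dist_of[OF assms])
  have eq: "{\<omega>. \<forall>i<N. \<omega> i = x i}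
      = prod_emb UNIV (\<lambda>_. dist_of P) {..<N} (\<Pi>\<^sub>E i\<in>{..<N}. {x i})"
    by (rule set_eqI) (simp add: prod_emb_iff restrict_PiE_iff Ball_def Pi_iff)
  show "{\<omega>. \<forall>i<N. \<omega> i = x i} \<in> sets (sampling P)"
    unfolding eq sampling_def by (intro sets_PiM_I) auto
  show "measure (sampling P) {\<omega>. \<forall>i<N. \<omega> i = x i} = (\<Prod>i<N. P $ x i)"
    unfolding eq sampling_def
    by (subst measure_PiM_emb) (auto simp: measure_dist_of_singleton[OF assms])
qed

text \<open>An event that depends only on the first \<open>N\<close> samples is a finite disjoint
  union of cylinders, one for each word of length \<open>N\<close> satisfying it. This yields both
  the measurability and the probability of every event about \<open>empirical N\<close>, including
  those expressed through a predictor.\<close>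

lemma
  fixes P :: "real ^ 's::finite"
  assumes P: "P \<in> prob_vecs"
    and E: "\<And>\<omega> \<omega>'. (\<And>i. i < N \<Longrightarrow> \<omega> i = \<omega>' i) \<Longrightarrow> E \<omega> \<longleftrightarrow> E \<omega>'"
  shows sets_sampling_prefix: "{\<omega>. E \<omega>} \<in> sets (sampling P)"
    and measure_sampling_prefix:
      "measure (sampling P) {\<omega>. E \<omega>} = (\<Sum>x \<in> {x \<in> {..<N} \<rightarrow>\<^sub>E UNIV. E x}. \<Prod>i<N. P $ x i)"
proof -
  let ?I = "{x \<in> {..<N} \<rightarrow>\<^sub>E UNIV. E x}"
  let ?C = "\<lambda>x. {\<omega>. \<forall>i<N. \<omega> i = x i}"
  interpret prob_space "sampling P" by (rule prob_space_sampling[OF P])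
  have fin: "finite ?I"
    by (rule finite_subset[of _ "{..<N} \<rightarrow>\<^sub>E UNIV"]) (auto intro: finite_PiE)
  have eq: "{\<omega>. E \<omega>} = (\<Union>x\<in>?I. ?C x)"
  proof (intro equalityI subsetI)
    fix \<omega> assume "\<omega> \<in> {\<omega>. E \<omega>}"
    moreover have "E \<omega> \<longleftrightarrow> E (restrict \<omega> {..<N})" by (rule E) simp
    ultimately have "restrict \<omega> {..<N} \<in> ?I" by auto
    moreover have "\<omega> \<in> ?C (restrict \<omega> {..<N})" by simp
    ultimately show "\<omega> \<in> (\<Union>x\<in>?I. ?C x)" by blast
  next
    fix \<omega> assume "\<omega> \<in> (\<Union>x\<in>?I. ?C x)"
    then obtain x where "E x" "\<And>i. i < N \<Longrightarrow> \<omega> i = x i" by auto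
    with E[of \<omega> x] show "\<omega> \<in> {\<omega>. E \<omega>}" by auto
  qed
  show "{\<omega>. E \<omega>} \<in> sets (sampling P)"
    unfolding eq by (intro sets.finite_UN fin sets_sampling_cylinder[OF P])
  \<comment> \<open>Words are extensional functions on \<open>{..<N}\<close>, so two distinct words
    differ at some index below \<open>N\<close> and their cylinders are disjoint.\<close>
  have "disjoint_family_on ?C ?I"
    unfolding disjoint_family_on_def
    by (auto simp: PiE_iff extensional_def fun_eq_iff) metis
  then have "measure (sampling P) (\<Union>x\<in>?I. ?C x) = (\<Sum>x\<in>?I. measure (sampling P) (?C x))"
    using fin sets_sampling_cylinder[OF P] by (intro finite_measure_finite_Union) auto
  then show "measure (sampling P) {\<omega>. E \<omega>} = (\<Sum>x\<in>?I. \<Prod>i<N. P $ x i)"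
    unfolding eq by (simp add: measure_sampling_cylinder[OF P])
qed

section \<open>Empirical distributions\<close>

lemma empirical_cong:
  "(\<And>i. i < N \<Longrightarrow> \<omega> i = \<omega>' i) \<Longrightarrow> empirical N \<omega> = empirical N \<omega>'"
  by (simp add: empirical_def)

lemma empirical_nth: "empirical N \<omega> $ s = (\<Sum>i<N. indicator {s} (\<omega> i)) / real N"
proof -
  have "axis (\<omega> i) 1 $ s = (indicator {s} (\<omega> i) :: real)" for i
    by (auto simp: axis_def)
  then show ?thesis by (simp add: empirical_def)
qed

text \<open>Samples are grouped by their value. With \<open>f\<close> a log-likelihood ratio, this
  makes the likelihood of a word a function of its empirical distribution.\<close>

lemma sum_empirical:
  fixes f :: "'s::finite \<Rightarrow> real"
  assumes "N > 0"
  shows "(\<Sum>i<N. f (\<omega> i)) = real N * (\<Sum>s\<in>UNIV. empirical N \<omega> $ s * f s)"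
proof -
  have "real N * (\<Sum>s\<in>UNIV. empirical N \<omega> $ s * f s)
      = (\<Sum>s\<in>UNIV. \<Sum>i<N. indicator {s} (\<omega> i) * f s)"
    using assms by (simp add: empirical_nth sum_distrib_left sum_distrib_right field_simps)
  also have "\<dots> = (\<Sum>i<N. \<Sum>s\<in>UNIV. indicator {s} (\<omega> i) * f s)"
    by (rule sum.swap)
  also have "\<dots> = (\<Sum>i<N. f (\<omega> i))"
  proof (rule sum.cong[OF refl])
    fix i
    have "(\<Sum>s\<in>UNIV. indicator {s} (\<omega> i) * f s) = (\<Sum>s\<in>UNIV. if s = \<omega> i then f s else 0)"
      by (intro sum.cong) auto
    then show "(\<Sum>s\<in>UNIV. indicator {s} (\<omega> i) * f s) = f (\<omega> i)" by simp
  qed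
  finally show ?thesis ..
qed

text \<open>The total mass comes from \<open>sum_empirical\<close> with the constant function 1. For
  \<open>N = 0\<close> the empirical vector is 0, since \<open>1 / 0 = 0\<close>, and lies outside
  the simplex.\<close>

lemma empirical_in_prob_vecs:
  assumes "N > 0"
  shows "empirical N \<omega> \<in> prob_vecs"
  using assms sum_empirical[of N "\<lambda>_. 1" \<omega>]
  by (auto simp: prob_vecs_def empirical_nth intro!: divide_nonneg_nonneg sum_nonneg)

section \<open>The weak law of large numbers\<close>

text \<open>Independence means that the joint law is the product of the marginals. Here the joint
  map is the identity on the product space and each marginal is \<open>dist_of Q\<close>.\<close>

lemma indep_vars_sampling:
  assumes "Q \<in> prob_vecs"
  shows "prob_space.indep_vars (sampling Q) (\<lambda>_. dist_of Q) (\<lambda>i \<omega>. \<omega> i) UNIV"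
proof -
  interpret product_prob_space "\<lambda>_::nat. dist_of Q" UNIV
    by (rule product_prob_space_dist_of[OF assms])
  have "distr (PiM UNIV (\<lambda>_. dist_of Q)) (dist_of Q) (\<lambda>\<omega>. \<omega> i) = dist_of Q" for i :: nat
    by (rule PiM_component) simp
  then show ?thesis
    unfolding sampling_def
    by (subst indep_vars_iff_distr_eq_PiM) (simp_all add: restrict_UNIV distr_id2)
qed

text \<open>Hoeffding's inequality for the indicators of \<open>\<omega> i = s\<close>, which are
  i.i.d. with values in [0,1] and mean \<open>Q $ s\<close>.\<close>

lemma empirical_coordinate_deviation:
  assumes Q: "Q \<in> prob_vecs" and \<delta>: "\<delta> \<ge> 0" and N: "N > 0"
  shows "measure (sampling Q) {\<omega>. \<bar>empirical N \<omega> $ s - Q $ s\<bar> \<ge> \<delta>} \<le> 2 * exp (- 2 * real N * \<delta>\<^sup>2)"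
proof -
  interpret prob_space "sampling Q" by (rule prob_space_sampling[OF Q])
  interpret D: product_prob_space "\<lambda>_::nat. dist_of Q" UNIV
    by (rule product_prob_space_dist_of[OF Q])
  let ?X = "\<lambda>i \<omega>. indicator {s} (\<omega> i) :: real"
  have [measurable]: "(\<lambda>\<omega>. \<omega> i) \<in> measurable (sampling Q) (dist_of Q)" for i
    unfolding sampling_def by simp
  have [measurable]: "f \<in> borel_measurable (dist_of Q)" for f :: "_ \<Rightarrow> real"
    by (simp add: measurable_def)
  have component: "distr (sampling Q) (dist_of Q) (\<lambda>\<omega>. \<omega> i) = dist_of Q" for i
    unfolding sampling_def by (rule D.PiM_component) simp
  have "distr (sampling Q) borel (?X i) = distr (dist_of Q) borel (indicator {s})" for i
    using distr_distr[of "indicator {s} :: _ \<Rightarrow> real" "dist_of Q" borel "\<lambda>\<omega>. \<omega> i" "sampling Q"]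
    by (simp add: component comp_def)
  then have distr: "distr (sampling Q) borel (?X i) = distr (sampling Q) borel (?X 0)" for i
    by simp
  have "indep_vars (\<lambda>_. borel) ?X UNIV"
    by (rule indep_vars_compose2[OF indep_vars_sampling[OF Q]]) simp
  then have indep: "indep_vars (\<lambda>_. borel) ?X {..<N}"
    by (rule indep_vars_subset) simp
  interpret Hoeffding_ineq_iid "sampling Q" "{..<N}" ?X "?X 0" 0 1 "expectation (?X 0)"
    by unfold_locales (use indep distr in \<open>auto simp: indicator_def\<close>)
  have "expectation (?X 0) = (\<integral>\<xi>. indicator {s} \<xi> \<partial>distr (sampling Q) (dist_of Q) (\<lambda>\<omega>. \<omega> 0))"
    by (subst integral_distr) auto
  also have "\<dots> = Q $ s"
    unfolding component using measure_dist_of_singleton[OF Q] by simp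
  finally have mean: "expectation (?X 0) = Q $ s" .
  have "{..<N} \<noteq> {}" using N by auto
  from Hoeffding_ineq_abs_ge'[OF \<delta> zero_less_one this] show ?thesis
    by (simp only: mean space_sampling card_lessThan empirical_nth) simp
qed

text \<open>A union bound over the finitely many coordinates turns the exponential tail of each into
  a lower bound that tends to 1.\<close>

lemma empirical_tendsto_in_probability:
  fixes Q :: "real ^ 's::finite"
  assumes Q: "Q \<in> prob_vecs" and \<delta>: "\<delta> > 0"
  shows "(\<lambda>N. measure (sampling Q) {\<omega>. \<forall>s. \<bar>empirical N \<omega> $ s - Q $ s\<bar> < \<delta>}) \<longlonglongrightarrow> 1"
proof (rule tendsto_sandwich)
  interpret prob_space "sampling Q" by (rule prob_space_sampling[OF Q])
  show "(\<lambda>N. 1 - real CARD('s) * (2 * exp (- 2 * real N * \<delta>\<^sup>2))) \<longlonglongrightarrow> 1"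
    using \<delta> by real_asymp
  show "\<forall>\<^sub>F N in sequentially. 1 - real CARD('s) * (2 * exp (- 2 * real N * \<delta>\<^sup>2))
      \<le> measure (sampling Q) {\<omega>. \<forall>s. \<bar>empirical N \<omega> $ s - Q $ s\<bar> < \<delta>}"
  proof (rule eventually_mono[OF eventually_gt_at_top[of 0]])
    fix N :: nat assume N: "N > 0"
    let ?B = "\<lambda>s. {\<omega>. \<bar>empirical N \<omega> $ s - Q $ s\<bar> \<ge> \<delta>}"
    have [measurable]: "?B s \<in> events" for s
      by (rule sets_sampling_prefix[OF Q, of N]) (metis empirical_cong)
    have "prob (\<Union>s. ?B s) \<le> (\<Sum>s\<in>UNIV. prob (?B s))"
      by (rule finite_measure_subadditive_finite) auto
    also have "\<dots> \<le> (\<Sum>s\<in>(UNIV::'s set). 2 * exp (- 2 * real N * \<delta>\<^sup>2))"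
      using \<delta> N by (intro sum_mono empirical_coordinate_deviation[OF Q]) auto
    also have "\<dots> = real CARD('s) * (2 * exp (- 2 * real N * \<delta>\<^sup>2))"
      by simp
    finally have "prob (\<Union>s. ?B s) \<le> \<dots>" .
    moreover have "{\<omega>. \<forall>s. \<bar>empirical N \<omega> $ s - Q $ s\<bar> < \<delta>} = space (sampling Q) - (\<Union>s. ?B s)"
      by (auto simp: not_le[symmetric])
    ultimately show "1 - real CARD('s) * (2 * exp (- 2 * real N * \<delta>\<^sup>2))
        \<le> prob {\<omega>. \<forall>s. \<bar>empirical N \<omega> $ s - Q $ s\<bar> < \<delta>}"
      by (simp only:) (subst prob_compl; simp)
  qed
  show "\<forall>\<^sub>F N in sequentially. prob {\<omega>. \<forall>s. \<bar>empirical N \<omega> $ s - Q $ s\<bar> < \<delta>} \<le> 1"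
    by simp
qed (rule tendsto_const)

section \<open>Change of measure and the lower bound of Sanov's theorem\<close>

text \<open>The likelihood ratio of \<open>P\<close> to \<open>Q\<close> on a word of positive
  \<open>Q\<close>-probability is \<open>exp\<close> of \<open>- N\<close> times the empirical mean
  of \<open>ln (Q / P)\<close>. On the event this is at least \<open>exp (- N * K)\<close>, and
  summing over the words in the event gives the claim.\<close>

lemma measure_sampling_change_of_measure:
  fixes P Q :: "real ^ 's::finite"
  assumes P: "P \<in> prob_vecs" and Q: "Q \<in> prob_vecs" and N: "N > 0"
    and ac: "\<And>s. P $ s = 0 \<Longrightarrow> Q $ s = 0"
    and K: "\<And>\<omega>. F (empirical N \<omega>) \<Longrightarrow> (\<Sum>s\<in>UNIV. empirical N \<omega> $ s * ln (Q $ s / P $ s)) \<le> K"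
  shows "exp (- real N * K) * measure (sampling Q) {\<omega>. F (empirical N \<omega>)}
    \<le> measure (sampling P) {\<omega>. F (empirical N \<omega>)}"
proof -
  have prefix: "F (empirical N \<omega>) \<longleftrightarrow> F (empirical N \<omega>')" if "\<And>i. i < N \<Longrightarrow> \<omega> i = \<omega>' i" for \<omega> \<omega>'
    using empirical_cong[OF that] by simp
  have nonneg: "P $ s \<ge> 0" "Q $ s \<ge> 0" for s
    using P Q by (auto simp: prob_vecs_def)
  have le: "exp (- real N * K) * (\<Prod>i<N. Q $ x i) \<le> (\<Prod>i<N. P $ x i)" if x: "F (empirical N x)" for x
  \<comment> \<open>A word of \<open>Q\<close>-probability 0 contributes nothing on the left. For
    all others \<open>ac\<close> makes every factor of \<open>P\<close> positive too, so the
    logarithms are genuine.\<close>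
  proof (cases "\<exists>i<N. Q $ x i = 0")
    case True
    then have "(\<Prod>i<N. Q $ x i) = 0" by (intro prod_zero) auto
    then show ?thesis using nonneg by (simp only: mult_zero_right) (simp add: prod_nonneg)
  next
    case False
    then have pos: "Q $ x i > 0" "P $ x i > 0" if "i < N" for i
      using that nonneg ac[of "x i"] by (metis less_eq_real_def)+
    have "(\<Sum>i<N. ln (Q $ x i / P $ x i)) \<le> real N * K"
      using K[OF x] by (simp add: sum_empirical[OF N, of "\<lambda>s. ln (Q $ s / P $ s)"] mult_left_mono)
    then have "exp (- real N * K) \<le> exp (- (\<Sum>i<N. ln (Q $ x i / P $ x i)))"
      by simp
    also have "\<dots> = (\<Prod>i<N. P $ x i / Q $ x i)"
      unfolding sum_negf[symmetric] exp_sum[OF finite_lessThan]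
      by (intro prod.cong refl) (simp add: exp_minus pos)
    finally have "exp (- real N * K) * (\<Prod>i<N. Q $ x i)
        \<le> (\<Prod>i<N. P $ x i / Q $ x i) * (\<Prod>i<N. Q $ x i)"
      using nonneg by (intro mult_right_mono prod_nonneg) auto
    also have "\<dots> = (\<Prod>i<N. P $ x i)"
      unfolding prod.distrib[symmetric]
      by (intro prod.cong refl) (use pos(1) in \<open>simp add: less_imp_neq[THEN not_sym]\<close>)
    finally show ?thesis .
  qed
  have eq: "measure (sampling R) {\<omega>. F (empirical N \<omega>)}
      = (\<Sum>x \<in> {x \<in> {..<N} \<rightarrow>\<^sub>E UNIV. F (empirical N x)}. \<Prod>i<N. R $ x i)"
    if "R \<in> prob_vecs" for R
    using that by (rule measure_sampling_prefix) (rule prefix)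
  show ?thesis
    unfolding eq[OF P] eq[OF Q] sum_distrib_left by (intro sum_mono le) simp
qed


lemma elog_mono:
  assumes "0 \<le> p" "p \<le> q"
  shows "elog p \<le> elog q"
  using assms by (auto simp: elog_def)

text \<open>On a small cube around \<open>Q\<close> the mean log-likelihood ratio is close to the
  divergence, while the cube carries almost all mass under \<open>Q\<close>. The change of measure
  transfers this mass to \<open>P\<close> at exponential cost close to
  \<open>KL_div Q P\<close>.\<close>

lemma sanov_lower_bound:
  fixes P Q :: "real ^ 's::finite"
  assumes P: "P \<in> prob_vecs" and Q: "Q \<in> prob_vecs"
    and U: "openin (top_of_set prob_vecs) U" and QU: "Q \<in> U"
  shows "- KL_div Q P
    \<le> liminf (\<lambda>N. ereal (1 / real N) * elog (measure (sampling P) {\<omega>. empirical N \<omega> \<in> U}))"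
proof (cases "\<forall>s. P $ s = 0 \<longrightarrow> Q $ s = 0")
  case False
  then have "KL_div Q P = \<infinity>" unfolding KL_div_def by (rule if_not_P)
  then show ?thesis by simp
next
  case ac: True
  interpret prob_space "sampling P" by (rule prob_space_sampling[OF P])
  \<comment> \<open>The log-likelihood ratio per sample, linear in \<open>v\<close>; its value at
    \<open>Q\<close> is the divergence.\<close>
  define g where "g v = (\<Sum>s\<in>UNIV. v $ s * ln (Q $ s / P $ s))" for v
  obtain T where T: "open T" "U = prob_vecs \<inter> T"
    using U by (auto simp: openin_open)
  \<comment> \<open>Half of the slack \<open>e\<close> pays for the variation of \<open>g\<close>
    near \<open>Q\<close>, the other half for a constant factor 1/2 in the probability.\<close>
  have approx: "ereal (- g Q - e)
      \<le> liminf (\<lambda>N. ereal (1 / real N) * elog (prob {\<omega>. empirical N \<omega> \<in> U}))"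
    if e: "e > 0" for e
  proof (rule Liminf_bounded)
    have "open {v. g v < g Q + e / 2}"
      unfolding g_def by (intro open_Collect_less continuous_intros)
    then have "open (T \<inter> {v. g v < g Q + e / 2})" "Q \<in> T \<inter> {v. g v < g Q + e / 2}"
      using T QU e by auto
    then obtain d where d: "d > 0" "ball Q d \<subseteq> T \<inter> {v. g v < g Q + e / 2}"
      using openE by blast
    \<comment> \<open>The Euclidean norm is at most the l1 norm, so a cube of half-width
      \<open>d / CARD('s)\<close> fits into the ball of radius \<open>d\<close>.\<close>
    define \<delta> where "\<delta> = d / real CARD('s)"
    have \<delta>: "\<delta> > 0" using d by (simp add: \<delta>_def)
    define F where "F v \<longleftrightarrow> (\<forall>s. \<bar>v $ s - Q $ s\<bar> < \<delta>)" for v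
    have F: "v \<in> T \<and> g v \<le> g Q + e / 2" if "F v" for v
    proof -
      have "norm (v - Q) \<le> (\<Sum>s\<in>UNIV. \<bar>(v - Q) $ s\<bar>)"
        by (rule norm_le_l1_cart)
      also have "\<dots> < (\<Sum>s\<in>(UNIV::'s set). \<delta>)"
        using that by (intro sum_strict_mono) (auto simp: F_def)
      also have "\<dots> = d" by (simp add: \<delta>_def)
      finally have "v \<in> ball Q d" by (simp add: dist_norm norm_minus_commute)
      then show ?thesis using d(2) by auto
    qed
    have "(\<lambda>N. measure (sampling Q) {\<omega>. F (empirical N \<omega>)}) \<longlonglongrightarrow> 1"
      unfolding F_def by (rule empirical_tendsto_in_probability[OF Q \<delta>])
    \<comment> \<open>Any fixed positive bound below 1 serves as well; 1/2 costs
      \<open>ln 2 / N\<close> in the exponent, which vanishes in the limit.\<close>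
    then have "\<forall>\<^sub>F N in sequentially. measure (sampling Q) {\<omega>. F (empirical N \<omega>)} > 1 / 2"
      by (rule order_tendstoD) simp
    moreover have "(\<lambda>N. ln 2 / real N) \<longlonglongrightarrow> 0" by real_asymp
    then have "\<forall>\<^sub>F N in sequentially. ln 2 / real N < e / 2"
      by (rule order_tendstoD) (use e in simp)
    ultimately show "\<forall>\<^sub>F N in sequentially. ereal (- g Q - e)
        \<le> ereal (1 / real N) * elog (prob {\<omega>. empirical N \<omega> \<in> U})"
      using eventually_gt_at_top[of 0]
    proof eventually_elim
      fix N :: nat
      assume half: "measure (sampling Q) {\<omega>. F (empirical N \<omega>)} > 1 / 2"
        and small: "ln 2 / real N < e / 2" and N: "N > 0"
      let ?p = "prob {\<omega>. empirical N \<omega> \<in> U}"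
      define B where "B = exp (- real N * (g Q + e / 2)) * (1 / 2)"
      have "B \<le> exp (- real N * (g Q + e / 2)) * measure (sampling Q) {\<omega>. F (empirical N \<omega>)}"
        unfolding B_def using half by (intro mult_left_mono) auto
      also have "\<dots> \<le> prob {\<omega>. F (empirical N \<omega>)}"
        using ac F by (intro measure_sampling_change_of_measure[OF P Q N]) (auto simp: g_def)
      also have "\<dots> \<le> ?p"
      proof (rule finite_measure_mono)
        show "{\<omega>. F (empirical N \<omega>)} \<subseteq> {\<omega>. empirical N \<omega> \<in> U}"
          using F empirical_in_prob_vecs[OF N] by (auto simp: T)
        show "{\<omega>. empirical N \<omega> \<in> U} \<in> events"
          by (rule sets_sampling_prefix[OF P, of N]) (metis empirical_cong)
      qed
      finally have B: "B \<le> ?p" .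
      have "B > 0" by (simp add: B_def)
      have "- g Q - e \<le> 1 / real N * (- real N * (g Q + e / 2) - ln 2)"
        using small N by (simp add: field_simps)
      also have "- real N * (g Q + e / 2) - ln 2 = ln B"
        by (simp add: B_def ln_mult ln_div)
      finally have "ereal (- g Q - e) \<le> ereal (1 / real N) * elog B"
        using \<open>B > 0\<close> by (simp add: elog_def)
      also have "\<dots> \<le> ereal (1 / real N) * elog ?p"
        using B \<open>B > 0\<close> by (intro ereal_mult_left_mono elog_mono) auto
      finally show "ereal (- g Q - e) \<le> \<dots>" .
    qed
  qed
  then have "ereal (- g Q)
      \<le> liminf (\<lambda>N. ereal (1 / real N) * elog (prob {\<omega>. empirical N \<omega> \<in> U})) + ereal e"
    if "e > 0" for e
  proof -
    have "ereal (- g Q - e) + ereal e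
        \<le> liminf (\<lambda>N. ereal (1 / real N) * elog (prob {\<omega>. empirical N \<omega> \<in> U})) + ereal e"
      by (intro add_right_mono approx[OF that])
    then show ?thesis by simp
  qed
  then have "ereal (- g Q) \<le> liminf (\<lambda>N. ereal (1 / real N) * elog (prob {\<omega>. empirical N \<omega> \<in> U}))"
    by (rule ereal_le_epsilon2)
  moreover have "KL_div Q P = ereal (g Q)"
    unfolding KL_div_def g_def by (rule if_P[OF ac])
  ultimately show ?thesis by (simp only: uminus_ereal.simps)
qed

section \<open>Divergence along a segment\<close>

lemma segment_in_prob_vecs:
  assumes "P \<in> prob_vecs" "Q \<in> prob_vecs" "0 \<le> t" "t \<le> 1"
  shows "(1 - t) *\<^sub>R P + t *\<^sub>R Q \<in> prob_vecs"
  using assms by (auto simp: prob_vecs_def sum.distrib sum_distrib_left[symmetric])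

text \<open>The divergence is convex in its second argument, by concavity of \<open>ln\<close>, and
  vanishes at \<open>Q\<close>; only the share \<open>1 - t\<close> of the bound at \<open>P\<close>
  survives.\<close>

lemma KL_div_segment_le:
  fixes P Q :: "real ^ 's::finite"
  assumes P: "P \<in> prob_vecs" and Q: "Q \<in> prob_vecs" and t: "0 < t" "t < 1"
    and K: "KL_div Q P \<le> ereal K"
  shows "KL_div Q ((1 - t) *\<^sub>R P + t *\<^sub>R Q) \<le> ereal ((1 - t) * K)"
proof -
  \<comment> \<open>The bound \<open>K\<close> is real, which excludes the value
    \<infinity>.\<close>
  have ac: "P $ s = 0 \<Longrightarrow> Q $ s = 0" for s
    using K by (auto simp: KL_div_def split: if_splits)
  have nonneg: "P $ s \<ge> 0" "Q $ s \<ge> 0" for s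
    using P Q by (auto simp: prob_vecs_def)
  have "Q $ s * ln (Q $ s / ((1 - t) * P $ s + t * Q $ s)) \<le> (1 - t) * (Q $ s * ln (Q $ s / P $ s))" for s
  proof (cases "Q $ s = 0")
    case False
    then have pos: "Q $ s > 0" "P $ s > 0"
      using nonneg ac[of s] by (metis less_eq_real_def)+
    have "(1 - t) * ln (P $ s) + t * ln (Q $ s) \<le> ln ((1 - t) * P $ s + t * Q $ s)"
      using concave_onD[OF ln_concave, of t "P $ s" "Q $ s"] pos t by simp
    moreover have "(1 - t) * P $ s + t * Q $ s > 0"
      using pos t by (simp add: add_pos_pos)
    ultimately have "ln (Q $ s / ((1 - t) * P $ s + t * Q $ s)) \<le> (1 - t) * ln (Q $ s / P $ s)"
      using pos by (simp add: ln_div algebra_simps)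
    then have "Q $ s * ln (Q $ s / ((1 - t) * P $ s + t * Q $ s)) \<le> Q $ s * ((1 - t) * ln (Q $ s / P $ s))"
      using pos by (intro mult_left_mono) auto
    then show ?thesis by (simp add: mult.left_commute)
  qed simp
  then have "(\<Sum>s\<in>UNIV. Q $ s * ln (Q $ s / ((1 - t) * P $ s + t * Q $ s)))
      \<le> (1 - t) * (\<Sum>s\<in>UNIV. Q $ s * ln (Q $ s / P $ s))"
    unfolding sum_distrib_left by (intro sum_mono)
  also have "\<dots> \<le> (1 - t) * K"
    using K ac t by (intro mult_left_mono) (auto simp: KL_div_def)
  finally have le: "(\<Sum>s\<in>UNIV. Q $ s * ln (Q $ s / ((1 - t) * P $ s + t * Q $ s))) \<le> (1 - t) * K" .
  have "Q $ s = 0" if "(1 - t) * P $ s + t * Q $ s = 0" for s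
    using that nonneg t by (auto simp: add_nonneg_eq_0_iff)
  with le show ?thesis by (simp add: KL_div_def)
qed

section \<open>Separation and contradiction with feasibility\<close>

theorem theorem4p5:
  fixes X :: "(real ^ 'm) set"
    and L :: "(real ^ 'm \<Rightarrow> 's::finite \<Rightarrow> real) set"
    and A :: "real ^ 's \<Rightarrow> (real ^ 's) set"
    and c :: "(real ^ 'm \<Rightarrow> 's \<Rightarrow> real) \<Rightarrow> real ^ 'm \<Rightarrow> real ^ 's \<Rightarrow> real"
    and r :: real
  assumes "X \<noteq> {}"
    and "2 \<le> CARD('s)"
    and "r > 0"
    and "{l. decision_free X l} \<subseteq> L"
    and "DRO_predictor X L A c"
    and "reasonably_feasible X c r"
  shows "\<forall>Q\<in>prob_vecs. {P \<in> prob_vecs. KL_div Q P \<le> ereal r} \<subseteq> A Q"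
proof (intro ballI subsetI, rule ccontr)
  fix Q P\<^sub>0 :: "real ^ 's"
  assume Q: "Q \<in> prob_vecs" and "P\<^sub>0 \<in> {P \<in> prob_vecs. KL_div Q P \<le> ereal r}"
    and notin: "P\<^sub>0 \<notin> A Q"
  then have P\<^sub>0: "P\<^sub>0 \<in> prob_vecs" "KL_div Q P\<^sub>0 \<le> ereal r" by auto
  obtain x where x: "x \<in> X" using assms(1) by blast
  have AQ: "A Q \<subseteq> prob_vecs" "A Q \<noteq> {}" "closed (A Q)" "convex (A Q)"
    using assms(5) Q by (auto simp: DRO_predictor_def)
  obtain a b where ab: "a \<bullet> P\<^sub>0 < b" "\<And>P. P \<in> A Q \<Longrightarrow> a \<bullet> P > b"
    using separating_hyperplane_closed_point[OF AQ(4,3) notin] by blast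
  \<comment> \<open>The sign turns the side of the hyperplane containing \<open>P\<^sub>0\<close>
    into the side of high cost. The loss ignores the decision, so any \<open>x\<close> in
    \<open>X\<close> can witness disappointment.\<close>
  define l :: "real ^ 'm \<Rightarrow> 's \<Rightarrow> real" where "l = (\<lambda>_ \<xi>. - a $ \<xi>)"
  have l: "decision_free X l"
    unfolding decision_free_def l_def by (intro exI[of _ "\<lambda>\<xi>. - a $ \<xi>"]) auto
  have cost_l: "cost l x P = - (a \<bullet> P)" if "P \<in> prob_vecs" for P
    by (simp add: cost_def integral_dist_of[OF that] l_def inner_vec_def sum_negf mult.commute)
  have c_l: "c l x Q = (SUP P\<in>A Q. cost l x P)" "usc_on prob_vecs (c l x)"
    using assms(4,5) l x Q by (auto simp: DRO_predictor_def)
  \<comment> \<open>The supremum keeps only a weak inequality; strictness will come from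
    \<open>P\<close>, whose cost exceeds \<open>- b\<close>.\<close>
  have "c l x Q \<le> - b"
    unfolding c_l(1) using AQ ab(2) by (intro cSUP_least) (auto simp: cost_l less_imp_le)
  \<comment> \<open>By continuity a small positive \<open>t\<close> keeps the mixture on the side of
    \<open>P\<^sub>0\<close>.\<close>
  have "((\<lambda>t. a \<bullet> ((1 - t) *\<^sub>R P\<^sub>0 + t *\<^sub>R Q)) \<longlongrightarrow> a \<bullet> P\<^sub>0) (at_right 0)"
    by (auto intro!: tendsto_eq_intros)
  then have "\<forall>\<^sub>F t in at_right 0. a \<bullet> ((1 - t) *\<^sub>R P\<^sub>0 + t *\<^sub>R Q) < b"
    using ab(1) by (rule order_tendstoD)
  moreover have "\<forall>\<^sub>F t in at_right (0::real). t \<in> {0<..<1}"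
    by (rule eventually_at_right_real) simp
  ultimately have "\<forall>\<^sub>F t in at_right 0. a \<bullet> ((1 - t) *\<^sub>R P\<^sub>0 + t *\<^sub>R Q) < b \<and> t \<in> {0<..<1}"
    by (rule eventually_conj)
  then obtain t where t: "a \<bullet> ((1 - t) *\<^sub>R P\<^sub>0 + t *\<^sub>R Q) < b" "0 < t" "t < 1"
    using eventually_happens'[OF trivial_limit_at_right_real] by fastforce
  define P where "P = (1 - t) *\<^sub>R P\<^sub>0 + t *\<^sub>R Q"
  have P: "P \<in> prob_vecs"
    unfolding P_def using P\<^sub>0 Q t by (intro segment_in_prob_vecs) auto
  have "KL_div Q P \<le> ereal ((1 - t) * r)"
    unfolding P_def using KL_div_segment_le[OF P\<^sub>0(1) Q t(2,3) P\<^sub>0(2)] .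
  \<comment> \<open>Strictness is what allows a contradiction: feasibility bounds the rate by
    \<open>- r\<close> only weakly, and \<open>KL_div Q P\<^sub>0\<close> may equal
    \<open>r\<close>. It holds because \<open>r > 0\<close> and \<open>t > 0\<close>.\<close>
  also have "\<dots> < ereal r" using t assms(3) by simp
  finally have KL: "KL_div Q P < ereal r" .
  \<comment> \<open>Upper semicontinuity at the level \<open>cost l x P\<close> makes this set
    relatively open, and an empirical distribution in it causes disappointment at
    \<open>x\<close>.\<close>
  define U where "U = {p \<in> prob_vecs. c l x p < cost l x P}"
  have U: "openin (top_of_set prob_vecs) U"
    using c_l(2) by (simp add: usc_on_def U_def)
  have "Q \<in> U"
    using \<open>c l x Q \<le> - b\<close> t(1) Q cost_l[OF P] by (simp add: U_def P_def)
  interpret prob_space "sampling P" by (rule prob_space_sampling[OF P])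
  let ?bad = "\<lambda>N. {\<omega>. \<exists>x\<in>X. cost l x P > c l x (empirical N \<omega>)}"
  have mono: "prob {\<omega>. empirical N \<omega> \<in> U} \<le> prob (?bad N)" for N
  proof (rule finite_measure_mono)
    show "{\<omega>. empirical N \<omega> \<in> U} \<subseteq> ?bad N" using x by (auto simp: U_def)
    show "?bad N \<in> events"
      by (rule sets_sampling_prefix[OF P, of N]) (metis empirical_cong)
  qed
  \<comment> \<open>The exponential rate of disappointment under \<open>P\<close> lies strictly
    above \<open>- r\<close> by the Sanov bound and at most at \<open>- r\<close> by
    feasibility.\<close>
  have "- ereal r < - KL_div Q P" using KL by (simp only: ereal_minus_less_minus)
  also have "\<dots> \<le> liminf (\<lambda>N. ereal (1 / real N) * elog (prob {\<omega>. empirical N \<omega> \<in> U}))"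
    by (rule sanov_lower_bound[OF P Q U \<open>Q \<in> U\<close>])
  also have "\<dots> \<le> liminf (\<lambda>N. ereal (1 / real N) * elog (prob (?bad N)))"
    using mono by (intro Liminf_mono always_eventually allI ereal_mult_left_mono elog_mono) auto
  also have "\<dots> \<le> limsup (\<lambda>N. ereal (1 / real N) * elog (prob (?bad N)))"
    by (rule Liminf_le_Limsup) simp
  also have "\<dots> \<le> (SUP P\<in>prob_vecs. limsup (\<lambda>N. ereal (1 / real N) *
      elog (\<P>(\<omega> in sampling P. \<exists>x\<in>X. cost l x P > c l x (empirical N \<omega>)))))"
    using SUP_upper[OF P, of "\<lambda>P. limsup (\<lambda>N. ereal (1 / real N) *
      elog (\<P>(\<omega> in sampling P. \<exists>x\<in>X. cost l x P > c l x (empirical N \<omega>))))"] by simp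
  also have "\<dots> \<le> - ereal r"
    using assms(6) l by (simp add: reasonably_feasible_def uniformly_feasible_def)
  finally show False by simp
qed

end
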